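(* Let $U_0\in C^\infty(\mathbb R)$ be such that $\partial_xU_0$ is minimal at $x_0$ with $$U_0(x_0)=c,\quad \partial_xU_0(x_0)<0,\quad \partial_x^jU_0(x_0)=0\ \text{ for } j=2,\dots,2i,\quad \partial_x^{2i+1}U_0(x_0)>0$$ for some $i\in\mathbb N^*$. Then the solution $U$ of Burgers equation $\partial_tU+U\partial_xU=0$ with $U(0,\cdot)=U_0$ blows up at time $T=-1/\partial_xU_0(x_0)$ at the point $x_\infty=x_0+cT$, with $$U(t,x)=\mu^{-1}(T-t)^{\frac1{2i}}\,\Psi_i\!\left(\mu\frac{x-x_0-ct}{(T-t)^{1+\frac1{2i}}}\right)+c+w(t,x),$$ where $$\mu=\left(\frac{\partial_x^{2i+1}U_0(x_0)}{(2i+1)!\,(-\partial_xU_0(x_0))^{2i+2}}\right)^{\frac1{2i}}$$ and where $$\frac{w(t,x)}{(T-t)^{\frac1{2i}}\,\Psi_i\!\left(\mu\frac{x-x_0-ct}{(T-t)^{1+\frac1{2i}}}\right)}\to0\qquad\text{as }(t,x)\to(T,x_\infty),\ t<T$$ (the quotient being considered at points where its denominator does not vanish).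
   Context: For $i\in\mathbb N^*$, $\Psi_i:\mathbb R\to\mathbb R$ is the odd, decreasing, analytic function defined by the implicit equation $X=-\Psi_i(X)-(\Psi_i(X))^{1+2i}$. Blow-up means that $U$ is smooth for $t<T$ and $\partial_xU$ becomes unbounded as $t\uparrow T$. *)

theory Defs
  imports "HOL-Analysis.Analysis"
begin

text \<open>
  Smoothness relative to a set: \<open>S\<close> is meant to be a convex set with nonempty interior, so that
  derivatives within \<open>S\<close> are unique. At boundary points derivatives are one-sided.
\<close>

primrec Ck_on :: "nat \<Rightarrow> 'a::real_normed_vector set \<Rightarrow> ('a \<Rightarrow> real) \<Rightarrow> bool" where
  "Ck_on 0 S f \<longleftrightarrow> continuous_on S f"
| "Ck_on (Suc k) S f \<longleftrightarrow>
     (\<exists>f'. (\<forall>p\<in>S. (f has_derivative f' p) (at p within S)) \<and> (\<forall>v. Ck_on k S (\<lambda>p. f' p v)))"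

definition smooth_on :: "'a::real_normed_vector set \<Rightarrow> ('a \<Rightarrow> real) \<Rightarrow> bool" where
  "smooth_on S f \<longleftrightarrow> (\<forall>k. Ck_on k S f)"

definition \<Psi> :: "nat \<Rightarrow> real \<Rightarrow> real" where
  "\<Psi> i X = (THE y. X = - y - y ^ (1 + 2 * i))"

lemma Psi_rhs_strict_antimono:
  fixes y z :: real
  assumes "y < z"
  shows "- z - z ^ (1 + 2 * i) < - y - y ^ (1 + 2 * i)"
proof -
  have "y ^ (1 + 2 * i) \<le> z ^ (1 + 2 * i)"
    using assms by (intro power_mono_odd) auto
  with assms show ?thesis by linarith
qed

lemma Psi_ex1: "\<exists>!y::real. X = - y - y ^ (1 + 2 * i)"
proof (rule ex_ex1I)
  let ?f = "\<lambda>y::real. - y - y ^ (1 + 2 * i)"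
  have "0 \<le> \<bar>X\<bar> ^ (1 + 2 * i)" by simp
  then have le: "?f \<bar>X\<bar> \<le> X" by linarith
  have "(- \<bar>X\<bar>) ^ (1 + 2 * i) = - (\<bar>X\<bar> ^ (1 + 2 * i))"
    by (rule power_minus_odd) simp
  with \<open>0 \<le> \<bar>X\<bar> ^ (1 + 2 * i)\<close> have ge: "X \<le> ?f (- \<bar>X\<bar>)" by linarith
  have "\<exists>y. - \<bar>X\<bar> \<le> y \<and> y \<le> \<bar>X\<bar> \<and> ?f y = X"
    by (rule IVT2'[where f = ?f, OF le ge]) (auto intro!: continuous_intros)
  then show "\<exists>y. X = ?f y" by metis
next
  fix y z :: real
  assume "X = - y - y ^ (1 + 2 * i)" "X = - z - z ^ (1 + 2 * i)"
  then show "y = z"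
    using Psi_rhs_strict_antimono[of y z i] Psi_rhs_strict_antimono[of z y i]
    by (metis less_irrefl linorder_neqE)
qed

lemma Psi_implicit: "X = - \<Psi> i X - \<Psi> i X ^ (1 + 2 * i)"
  unfolding \<Psi>_def by (rule theI'[OF Psi_ex1])

lemma Psi_eqI: "X = - y - y ^ (1 + 2 * i) \<Longrightarrow> \<Psi> i X = y"
  using Psi_ex1[of X i] Psi_implicit[of X i] by blast

lemma Psi_odd: "\<Psi> i (- X) = - \<Psi> i X"
proof (rule Psi_eqI)
  have "(- \<Psi> i X) ^ (1 + 2 * i) = - (\<Psi> i X ^ (1 + 2 * i))"
    by (rule power_minus_odd) simp
  then show "- X = - (- \<Psi> i X) - (- \<Psi> i X) ^ (1 + 2 * i)"
    using Psi_implicit[of X i] by linarith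
qed

lemma Psi_strict_antimono: "X < Y \<Longrightarrow> \<Psi> i Y < \<Psi> i X"
  using Psi_implicit[of X i] Psi_implicit[of Y i]
    Psi_rhs_strict_antimono[of "\<Psi> i X" "\<Psi> i Y" i]
  by (metis less_asym linorder_neqE less_irrefl)

text \<open>
  A smooth solution on \<open>[0, S) \<times> \<real>\<close>; \<open>U t x\<close> has the time variable first. The time derivative
  at \<open>t = 0\<close> is the right derivative.
\<close>

definition burgers_solution :: "real \<Rightarrow> (real \<Rightarrow> real) \<Rightarrow> (real \<Rightarrow> real \<Rightarrow> real) \<Rightarrow> bool" where
  "burgers_solution S U0 U \<longleftrightarrow>
     smooth_on ({0..<S} \<times> UNIV) (\<lambda>(t, x). U t x) \<and>
     (\<forall>t\<in>{0..<S}. \<forall>x.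
        vector_derivative (\<lambda>s. U s x) (at t within {0..<S}) + U t x * deriv (U t) x = 0) \<and>
     (\<forall>x. U 0 x = U0 x)"

text \<open>
  Uniqueness and maximality together: any smooth solution on some \<open>[0, S) \<times> \<real>\<close> is a restriction
  of \<open>U\<close>.
\<close>

definition maximal_burgers_solution :: "real \<Rightarrow> (real \<Rightarrow> real) \<Rightarrow> (real \<Rightarrow> real \<Rightarrow> real) \<Rightarrow> bool" where
  "maximal_burgers_solution T U0 U \<longleftrightarrow>
     burgers_solution T U0 U \<and>
     (\<forall>S V. 0 < S \<longrightarrow> burgers_solution S U0 V \<longrightarrow>
        S \<le> T \<and> (\<forall>t\<in>{0..<S}. \<forall>x. V t x = U t x))"

text \<open>
  The supremum of \<open>\<bar>\<partial>\<^sub>x U(t, \<cdot>)\<bar>\<close> over each neighbourhood of \<open>a\<close> tends to infinity as \<open>t \<up> T\<close>.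
  The localisation matters: \<open>\<partial>\<^sub>x U(t, \<cdot>)\<close> may be unbounded at spatial infinity already at time 0.
\<close>

definition blows_up_at :: "(real \<Rightarrow> real \<Rightarrow> real) \<Rightarrow> real \<Rightarrow> real \<Rightarrow> bool" where
  "blows_up_at U T a \<longleftrightarrow>
     0 < T \<and> smooth_on ({0..<T} \<times> UNIV) (\<lambda>(t, x). U t x) \<and>
     (\<forall>\<epsilon>>0. \<forall>M. \<forall>\<^sub>F t in at_left T. \<exists>x\<in>ball a \<epsilon>. M < \<bar>deriv (U t) x\<bar>)"

end

theory Submission
  imports Defs
begin

text \<open>
  Along the ray \<open>t \<mapsto> y + t * U0 y\<close> any smooth solution \<open>V\<close> satisfies a linear homogeneous ODE for
  \<open>V - U0 y\<close>, hence is constant; this gives uniqueness, and differentiating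
  \<open>V T (y + T * U0 y) = U0 y\<close> at \<open>x0\<close> shows that no solution exists past \<open>T\<close>. Before \<open>T\<close> the
  rays foliate the strip and inverting them produces the solution.

  For the profile, put \<open>a = - deriv U0 x0 = 1 / T\<close> and
  \<open>b = (deriv ^^ (2 * i + 1)) U0 x0 / fact (2 * i + 1)\<close>. The foot \<open>x0 + y\<close> of the ray through
  \<open>(t, x)\<close> solves \<open>x - x0 - c t = a (T - t) y + t (b + o(1)) y ^ (2 * i + 1)\<close>, whereas the leading
  term of \<open>U - c\<close> equals \<open>- a z\<close> with \<open>x - x0 - c t = a (T - t) z + T b z ^ (2 * i + 1)\<close>. A
  relative perturbation of the leading coefficient moves the root by at most the same relative
  amount, so \<open>z / y \<rightarrow> 1\<close>.
\<close>

subsection \<open>Calculus of \<open>Ck_on\<close>\<close>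

lemma Ck_on_SucD: "Ck_on (Suc k) S f \<Longrightarrow> Ck_on k S f"
proof (induction k arbitrary: f)
  case 0
  then show ?case
    by (auto intro: has_derivative_continuous_on)
next
  case (Suc k)
  then show ?case
    by (metis Ck_on.simps(2))
qed

lemma Ck_on_const: "Ck_on k S (\<lambda>_. c)"
proof (induction k arbitrary: c)
  case (Suc k)
  have "((\<lambda>_. c) has_derivative (\<lambda>_. 0)) (at p within S)" for p
    by simp
  with Suc show ?case
    unfolding Ck_on.simps by (intro exI[of _ "\<lambda>_ _. 0"]) auto
qed auto

lemma Ck_on_bounded_linear:
  assumes "bounded_linear L"
  shows "Ck_on k S L"
proof (cases k)
  case 0
  then show ?thesis
    using assms by (simp add: linear_continuous_on)
next
  case (Suc m)
  then show ?thesis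
    using assms by (auto intro!: exI[of _ "\<lambda>_. L"] bounded_linear_imp_has_derivative Ck_on_const)
qed

lemma Ck_on_add:
  "Ck_on k S f \<Longrightarrow> Ck_on k S g \<Longrightarrow> Ck_on k S (\<lambda>p. f p + g p)"
proof (induction k arbitrary: f g)
  case 0
  then show ?case by (auto intro: continuous_on_add)
next
  case (Suc k)
  obtain f' g' where f': "\<forall>p\<in>S. (f has_derivative f' p) (at p within S)" "\<forall>v. Ck_on k S (\<lambda>p. f' p v)"
    and g': "\<forall>p\<in>S. (g has_derivative g' p) (at p within S)" "\<forall>v. Ck_on k S (\<lambda>p. g' p v)"
    using Suc.prems by auto
  then show ?case
    by (auto intro!: exI[of _ "\<lambda>p v. f' p v + g' p v"] has_derivative_add Suc.IH)
qed

lemma Ck_on_mult: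
  "Ck_on k S f \<Longrightarrow> Ck_on k S g \<Longrightarrow> Ck_on k S (\<lambda>p. f p * g p)"
proof (induction k arbitrary: f g)
  case 0
  then show ?case by (auto intro: continuous_on_mult)
next
  case (Suc k)
  obtain f' g' where f': "\<forall>p\<in>S. (f has_derivative f' p) (at p within S)" "\<forall>v. Ck_on k S (\<lambda>p. f' p v)"
    and g': "\<forall>p\<in>S. (g has_derivative g' p) (at p within S)" "\<forall>v. Ck_on k S (\<lambda>p. g' p v)"
    using Suc.prems by auto
  moreover have "Ck_on k S f" "Ck_on k S g"
    using Suc.prems Ck_on_SucD by blast+
  ultimately show ?case
    by (auto intro!: exI[of _ "\<lambda>p v. f p * g' p v + f' p v * g p"] has_derivative_mult Ck_on_add Suc.IH)
qed

text \<open>The derivative of \<open>1 / f\<close> is built from \<open>f'\<close> and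
  \<open>1 / f\<close> itself, so the regularity of \<open>1 / f\<close> bootstraps one order at a
  time.\<close>

lemma Ck_on_inverse:
  assumes "\<And>p. p \<in> S \<Longrightarrow> f p \<noteq> 0"
  shows "Ck_on k S f \<Longrightarrow> Ck_on k S (\<lambda>p. inverse (f p))"
proof (induction k)
  case 0
  then show ?case using assms by (auto intro: continuous_on_inverse)
next
  case (Suc k)
  obtain f' where f': "\<forall>p\<in>S. (f has_derivative f' p) (at p within S)" "\<forall>v. Ck_on k S (\<lambda>p. f' p v)"
    using Suc.prems by auto
  have inv: "Ck_on k S (\<lambda>p. inverse (f p))"
    using Suc Ck_on_SucD by blast
  have "Ck_on k S (\<lambda>p. (-1) * (inverse (f p) * f' p v * inverse (f p)))" for v
    using f' inv by (intro Ck_on_mult Ck_on_const) auto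
  then have "Ck_on k S (\<lambda>p. - (inverse (f p) * f' p v * inverse (f p)))" for v
    by simp
  with f' assms show ?case
    by (auto intro!: exI[of _ "\<lambda>p v. - (inverse (f p) * f' p v * inverse (f p))"] has_derivative_inverse)
qed

lemma smooth_on_UNIV_has_deriv:
  fixes f :: "real \<Rightarrow> real"
  assumes "smooth_on UNIV f"
  shows "(f has_real_derivative deriv f x) (at x)"
proof -
  from assms have "Ck_on (Suc 0) UNIV f"
    unfolding smooth_on_def by blast
  then obtain f' where "(f has_derivative f') (at x)"
    by auto
  then show ?thesis
    by (metis DERIV_deriv_iff_real_differentiable differentiableI)
qed

text \<open>The derivative family inside \<open>Ck_on\<close> is only an existential witness. On the
  whole line uniqueness of derivatives identifies its value in direction 1 with
  \<open>deriv f\<close>, which therefore inherits the regularity.\<close>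

lemma smooth_on_UNIV_deriv:
  fixes f :: "real \<Rightarrow> real"
  assumes "smooth_on UNIV f"
  shows "smooth_on UNIV (deriv f)"
  unfolding smooth_on_def
proof
  fix k
  from assms have "Ck_on (Suc k) UNIV f"
    unfolding smooth_on_def by blast
  then obtain f' where f': "\<And>p. (f has_derivative f' p) (at p)" "\<And>v. Ck_on k UNIV (\<lambda>p. f' p v)"
    by auto
  have "deriv f = (\<lambda>p. f' p 1)"
  proof
    fix p
    have "f' p = (*) (deriv f p)"
      using smooth_on_UNIV_has_deriv[OF assms, of p] f'(1)[of p]
      by (metis has_derivative_unique has_field_derivative_def)
    then show "deriv f p = f' p 1"
      by simp
  qed
  with f'(2) show "Ck_on k UNIV (deriv f)"
    by simp
qed

lemma smooth_on_UNIV_higher_deriv: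
  fixes f :: "real \<Rightarrow> real"
  assumes "smooth_on UNIV f"
  shows "smooth_on UNIV ((deriv ^^ n) f)"
  by (induction n) (auto simp: assms smooth_on_UNIV_deriv)

text \<open>The chain rule replaces \<open>g\<close> by \<open>deriv g\<close>, so the induction has
  to generalise over all smooth \<open>g\<close>.\<close>

lemma Ck_on_compose:
  fixes g :: "real \<Rightarrow> real"
  shows "smooth_on UNIV g \<Longrightarrow> Ck_on k S f \<Longrightarrow> Ck_on k S (\<lambda>p. g (f p))"
proof (induction k arbitrary: g)
  case 0
  have "continuous_on UNIV g"
    using 0(1) unfolding smooth_on_def by (metis Ck_on.simps(1))
  with 0 show ?case
    by (auto intro: continuous_on_compose2)
next
  case (Suc k)
  obtain f' where f': "\<forall>p\<in>S. (f has_derivative f' p) (at p within S)" "\<forall>v. Ck_on k S (\<lambda>p. f' p v)"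
    using Suc.prems by auto
  have "Ck_on k S f"
    using Suc.prems Ck_on_SucD by blast
  then have "Ck_on k S (\<lambda>p. deriv g (f p) * f' p v)" for v
    using Suc.IH[OF smooth_on_UNIV_deriv[OF Suc.prems(1)]] f'(2) by (intro Ck_on_mult) blast+
  moreover have "((\<lambda>p. g (f p)) has_derivative (\<lambda>v. deriv g (f p) * f' p v)) (at p within S)"
    if "p \<in> S" for p
    using has_derivative_compose[of f "f' p" p S g "(*) (deriv g (f p))"] f' that
      smooth_on_UNIV_has_deriv[OF Suc.prems(1)] by (auto simp: has_field_derivative_def)
  ultimately show ?case
    unfolding Ck_on.simps by (intro exI[of _ "\<lambda>p v. deriv g (f p) * f' p v"]) simp
qed

section \<open>Taylor's formula and Caratheodory's criterion\<close>

lemma taylor_continuous_remainder: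
  fixes f :: "real \<Rightarrow> real"
  assumes f: "smooth_on UNIV f" and "0 < n"
  obtains r where "isCont r a" "r a = (deriv ^^ n) f a / fact n"
    "\<And>x. f x = (\<Sum>m<n. (deriv ^^ m) f a / fact m * (x - a) ^ m) + r x * (x - a) ^ n"
proof -
  have D: "((deriv ^^ m) f has_real_derivative (deriv ^^ Suc m) f x) (at x)" for m x
    using smooth_on_UNIV_has_deriv[OF smooth_on_UNIV_higher_deriv[OF f]] by simp
  have ex: "\<exists>\<xi>. \<bar>\<xi> - a\<bar> \<le> \<bar>x - a\<bar> \<and>
      f x = (\<Sum>m<n. (deriv ^^ m) f a / fact m * (x - a) ^ m) + (deriv ^^ n) f \<xi> / fact n * (x - a) ^ n" for x
  proof (cases "x = a")
    case True
    obtain n' where n': "n = Suc n'"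
      using \<open>0 < n\<close> by (cases n) auto
    show ?thesis
      unfolding True n' sum.lessThan_Suc_shift by (intro exI[of _ a]) simp
  next
    case False
    have "\<exists>t. (if x < a then x < t \<and> t < a else a < t \<and> t < x) \<and>
        f x = (\<Sum>m<n. (deriv ^^ m) f a / fact m * (x - a) ^ m) + (deriv ^^ n) f t / fact n * (x - a) ^ n"
      using False D \<open>0 < n\<close>
      by (intro Taylor[where a = "min x a" and b = "max x a"]) auto
    then obtain t where "\<bar>t - a\<bar> \<le> \<bar>x - a\<bar>"
        "f x = (\<Sum>m<n. (deriv ^^ m) f a / fact m * (x - a) ^ m) + (deriv ^^ n) f t / fact n * (x - a) ^ n"
      by (force split: if_split_asm simp del: times_divide_eq_left)
    then show ?thesis
      by (intro exI[of _ t] conjI)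
  qed
  \<comment> \<open>The Lagrange point is chosen with no control over its dependence on
    \<open>x\<close>. Lying no farther from \<open>a\<close> than \<open>x\<close> does, it is
    nevertheless continuous at \<open>a\<close>, and this suffices for the remainder
    coefficient.\<close>
  obtain \<xi> where \<xi>: "\<forall>x. \<bar>\<xi> x - a\<bar> \<le> \<bar>x - a\<bar> \<and>
    f x = (\<Sum>m<n. (deriv ^^ m) f a / fact m * (x - a) ^ m) + (deriv ^^ n) f (\<xi> x) / fact n * (x - a) ^ n"
    using choice[OF allI[OF ex]] ..
  have \<xi>a: "\<xi> a = a"
    using spec[OF \<xi>, of a] by simp
  have "((\<lambda>x. \<xi> x - a) \<longlongrightarrow> 0) (at a)"
  proof (rule Lim_null_comparison)
    show "\<forall>\<^sub>F x in at a. norm (\<xi> x - a) \<le> \<bar>x - a\<bar>"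
      using \<xi> by simp
    show "((\<lambda>x. \<bar>x - a\<bar>) \<longlongrightarrow> 0) (at a)"
      by (intro tendsto_eq_intros) auto
  qed
  then have "isCont \<xi> a"
    unfolding isCont_def \<xi>a by (simp add: LIM_zero_iff)
  moreover have "isCont ((deriv ^^ n) f) (\<xi> a)"
    using D by (rule DERIV_isCont)
  ultimately have "isCont (\<lambda>x. (deriv ^^ n) f (\<xi> x)) a"
    by (rule isCont_o2)
  then have "isCont (\<lambda>x. (deriv ^^ n) f (\<xi> x) / fact n) a"
    by (intro isCont_divide) auto
  then show ?thesis
    using that[of "\<lambda>x. (deriv ^^ n) f (\<xi> x) / fact n"] \<xi> \<xi>a by auto
qed

text \<open>If increments factor as a fixed linear form times a convergent function, the
  linearisation error is the linear form times \<open>h q - c\<close>, which is o(|q - p|). This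
  differentiates an implicitly defined function relative to a set with boundary, here the strip
  including \<open>t = 0\<close>.\<close>

lemma has_derivative_caratheodory:
  fixes f :: "'a::real_normed_vector \<Rightarrow> real"
  assumes L: "bounded_linear L"
    and h: "(h \<longlongrightarrow> c) (at p within S)"
    and eq: "\<And>q. q \<in> S \<Longrightarrow> f q - f p = L (q - p) * h q"
  shows "(f has_derivative (\<lambda>v. L v * c)) (at p within S)"
proof -
  interpret bounded_linear L by fact
  obtain K where K: "\<And>v. \<bar>L v\<bar> \<le> norm v * K"
    using bounded by auto
  have "((\<lambda>q. norm (f q - f p - L (q - p) * c) / norm (q - p)) \<longlongrightarrow> 0) (at p within S)"
  proof (rule Lim_null_comparison)
    show "((\<lambda>q. K * \<bar>h q - c\<bar>) \<longlongrightarrow> 0) (at p within S)"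
      using h by (intro tendsto_mult_right_zero tendsto_rabs_zero) (simp add: LIM_zero)
    show "\<forall>\<^sub>F q in at p within S.
        norm (norm (f q - f p - L (q - p) * c) / norm (q - p)) \<le> K * \<bar>h q - c\<bar>"
      unfolding eventually_at_filter
    proof (intro always_eventually allI impI)
      fix q assume q: "q \<noteq> p" "q \<in> S"
      have "\<bar>f q - f p - L (q - p) * c\<bar> = \<bar>L (q - p)\<bar> * \<bar>h q - c\<bar>"
        using eq[OF q(2)] by (simp add: abs_mult[symmetric] algebra_simps)
      also have "\<dots> \<le> (norm (q - p) * K) * \<bar>h q - c\<bar>"
        by (intro mult_right_mono K) auto
      finally show "norm (norm (f q - f p - L (q - p) * c) / norm (q - p)) \<le> K * \<bar>h q - c\<bar>"
        using q by (simp add: field_simps)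
    qed
  qed
  moreover have "bounded_linear (\<lambda>v. L v * c)"
    by (rule bounded_linear_mult_const[OF L])
  ultimately show ?thesis
    by (simp add: has_derivative_iff_norm)
qed

subsection \<open>Uniqueness along rays\<close>

text \<open>Gronwall's argument: with \<open>K\<close> a bound for \<open>\<bar>k\<bar>\<close>, the
  function \<open>h^2 exp (- 2 K t)\<close> is nonincreasing, nonnegative and zero at time
  0.\<close>

lemma linear_ode_zero:
  fixes h k :: "real \<Rightarrow> real"
  assumes "0 \<le> \<tau>" and "h 0 = 0"
    and k: "continuous_on {0..\<tau>} k"
    and h: "\<And>t. t \<in> {0..\<tau>} \<Longrightarrow> (h has_real_derivative k t * h t) (at t within {0..\<tau>})"
  shows "h \<tau> = 0"
proof -
  have "bounded (k ` {0..\<tau>})"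
    by (intro compact_imp_bounded compact_continuous_image k) auto
  then obtain K where "\<forall>t\<in>{0..\<tau>}. \<bar>k t\<bar> \<le> K"
    by (auto simp: bounded_iff)
  then have K: "\<bar>k t\<bar> \<le> K" if "t \<in> {0..\<tau>}" for t
    using that by blast
  define E where "E = (\<lambda>t. (h t)\<^sup>2 * exp (- 2 * K * t))"
  have "continuous_on {0..\<tau>} h"
    by (rule DERIV_continuous_on[OF h])
  then have "continuous_on {0..\<tau>} E"
    unfolding E_def by (intro continuous_intros)
  moreover have "\<exists>d. (E has_real_derivative d) (at t) \<and> d \<le> 0" if "0 < t" "t < \<tau>" for t
  proof -
    have "(h has_real_derivative k t * h t) (at t)"
      using h[of t] that by (simp add: at_within_Icc_at)
    then have "(E has_real_derivative (2 * (k t - K) * (h t)\<^sup>2 * exp (- 2 * K * t))) (at t)"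
      unfolding E_def by (auto intro!: derivative_eq_intros simp: algebra_simps power2_eq_square)
    moreover have "2 * (k t - K) * ((h t)\<^sup>2 * exp (- 2 * K * t)) \<le> 0"
      using K[of t] that by (intro mult_nonpos_nonneg[of "2 * (k t - K)"]) auto
    then have "2 * (k t - K) * (h t)\<^sup>2 * exp (- 2 * K * t) \<le> 0"
      by (simp add: mult.assoc)
    ultimately show ?thesis by blast
  qed
  ultimately have "E \<tau> \<le> E 0"
    by (intro DERIV_nonpos_imp_decreasing_open[OF \<open>0 \<le> \<tau>\<close>])
  then have "(h \<tau>)\<^sup>2 \<le> 0"
    by (simp add: E_def \<open>h 0 = 0\<close> mult_le_0_iff del: power2_less_eq_zero_iff)
  then show ?thesis by simp
qed

lemma time_space_slices:
  assumes D: "((\<lambda>(t, x). V t x) has_derivative D) (at (t, x) within {0..<S} \<times> UNIV)"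
    and t: "t \<in> {0..<S}"
  shows "vector_derivative (\<lambda>s. V s x) (at t within {0..<S}) = D (1, 0)"
    and "(V t has_real_derivative D (0, 1)) (at x)"
proof -
  interpret D: bounded_linear D
    by (rule has_derivative_bounded_linear[OF D])
  have "((\<lambda>s. (s, x)) has_derivative (\<lambda>d. (d, 0))) (at t within {0..<S})"
    by (auto intro!: derivative_eq_intros)
  from has_derivative_in_compose[OF this has_derivative_subset[OF D]]
  have "((\<lambda>s. V s x) has_derivative (\<lambda>d. D (d, 0))) (at t within {0..<S})"
    by auto
  moreover have "(\<lambda>d. D (d, 0)) = (\<lambda>d. d *\<^sub>R D (1, 0))"
  proof
    show "D (d, 0) = d *\<^sub>R D (1, 0)" for d
      using D.scaleR[of d "(1, 0)"] by simp
  qed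
  ultimately have "((\<lambda>s. V s x) has_vector_derivative D (1, 0)) (at t within {0..<S})"
    by (simp add: has_vector_derivative_def)
  \<comment> \<open>A \<open>vector_derivative\<close> is determined only at limit points of the
    interval; this covers the one-sided case \<open>t = 0\<close> too.\<close>
  moreover have "at t within {0..<S} \<noteq> bot"
    using t by (auto simp: trivial_limit_within intro!: islimpt_closure_open[where s = "{0<..<S}"])
  ultimately show "vector_derivative (\<lambda>s. V s x) (at t within {0..<S}) = D (1, 0)"
    by (rule vector_derivative_within[rotated])
  have "((\<lambda>y. (t, y)) has_derivative (\<lambda>d. (0, d))) (at x)"
    by (auto intro!: derivative_eq_intros)
  moreover have "((\<lambda>(t, x). V t x) has_derivative D) (at (t, x) within range (Pair t))"
    using t by (intro has_derivative_subset[OF D]) auto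
  ultimately have "(V t has_derivative (\<lambda>d. D (0, d))) (at x)"
    using has_derivative_in_compose[of "Pair t" "Pair 0" x UNIV "\<lambda>(t, x). V t x" D] by simp
  moreover have "(\<lambda>d. D (0, d)) = (*) (D (0, 1))"
  proof
    show "D (0, d) = D (0, 1) * d" for d
      using D.scaleR[of d "(0, 1)"] by simp
  qed
  ultimately show "(V t has_real_derivative D (0, 1)) (at x)"
    by (simp add: has_field_derivative_def)
qed

text \<open>The straight line with the initial velocity \<open>u y\<close> is used instead of the
  integral curve of \<open>V\<close>, so no nonlinear ODE has to be solved. The deviation
  \<open>h\<close> of \<open>V\<close> from \<open>u y\<close> on this line satisfies
  \<open>h' = - V_x h\<close> and vanishes at time 0.\<close>

lemma burgers_solution_const_on_rays:
  assumes V: "burgers_solution S u V" and \<tau>: "0 \<le> \<tau>" "\<tau> < S"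
  shows "V \<tau> (y + \<tau> * u y) = u y"
proof -
  have "Ck_on (Suc 0) ({0..<S} \<times> UNIV) (\<lambda>(t, x). V t x)"
    using V unfolding burgers_solution_def smooth_on_def by blast
  then obtain D where
    D': "\<forall>p\<in>{0..<S} \<times> UNIV. ((\<lambda>(t, x). V t x) has_derivative D p) (at p within {0..<S} \<times> UNIV)"
    and contD: "\<forall>v. continuous_on ({0..<S} \<times> UNIV) (\<lambda>p. D p v)"
    unfolding Ck_on.simps by blast
  have D: "((\<lambda>(t, x). V t x) has_derivative D (t, x)) (at (t, x) within {0..<S} \<times> UNIV)"
    if "t \<in> {0..<S}" for t x
    using D' that by blast
  define \<gamma> where "\<gamma> t = (t, y + t * u y)" for t
  define h where "h t = V t (y + t * u y) - u y" for t
  have "(h has_real_derivative - D (\<gamma> t) (0, 1) * h t) (at t within {0..\<tau>})" if t: "t \<in> {0..\<tau>}" for t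
  proof -
    have tS: "t \<in> {0..<S}"
      using t \<tau> by auto
    interpret D: bounded_linear "D (\<gamma> t)"
      unfolding \<gamma>_def by (rule has_derivative_bounded_linear[OF D[OF tS]])
    note slices = time_space_slices[OF D[OF tS] tS, of "y + t * u y"]
    have "vector_derivative (\<lambda>s. V s (y + t * u y)) (at t within {0..<S})
        + V t (y + t * u y) * deriv (V t) (y + t * u y) = 0"
      using V tS unfolding burgers_solution_def by blast
    then have pde: "D (\<gamma> t) (1, 0) + V t (y + t * u y) * D (\<gamma> t) (0, 1) = 0"
      using slices DERIV_imp_deriv[OF slices(2)] by (simp add: \<gamma>_def)
    have "(\<gamma> has_derivative (\<lambda>d. (d, d * u y))) (at t within {0..\<tau>})"
      unfolding \<gamma>_def by (auto intro!: derivative_eq_intros)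
    moreover have "((\<lambda>(t, x). V t x) has_derivative D (\<gamma> t)) (at (\<gamma> t) within \<gamma> ` {0..\<tau>})"
      using \<tau> unfolding \<gamma>_def by (intro has_derivative_subset[OF D[OF tS]]) auto
    ultimately have "((\<lambda>s. V s (y + s * u y)) has_derivative (\<lambda>d. D (\<gamma> t) (d, d * u y))) (at t within {0..\<tau>})"
      using has_derivative_in_compose[of \<gamma> _ t "{0..\<tau>}"] by (fastforce simp: \<gamma>_def)
    \<comment> \<open>The equation annihilates the derivative in direction \<open>(1, V)\<close>;
      the direction \<open>(1, u y)\<close> of the ray differs from it by \<open>(0, - h)\<close>,
      which leaves a term linear in \<open>h\<close>.\<close>
    moreover have "D (\<gamma> t) (d, d * u y) = (- D (\<gamma> t) (0, 1) * h t) * d" for d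
    proof -
      have "D (\<gamma> t) (d, d * u y) = D (\<gamma> t) (d *\<^sub>R (1, 0) + (d * u y) *\<^sub>R (0, 1))"
        by simp
      also have "\<dots> = d * D (\<gamma> t) (1, 0) + d * u y * D (\<gamma> t) (0, 1)"
        unfolding D.add D.scaleR by simp
      also have "D (\<gamma> t) (1, 0) = - (V t (y + t * u y) * D (\<gamma> t) (0, 1))"
        using pde by linarith
      finally show ?thesis
        by (simp add: h_def algebra_simps)
    qed
    ultimately show ?thesis
      unfolding h_def has_field_derivative_def by (auto intro!: derivative_eq_intros)
  qed
  moreover have "continuous_on {0..\<tau>} (\<lambda>t. - D (\<gamma> t) (0, 1))"
    using \<tau> unfolding \<gamma>_def
    by (intro continuous_intros continuous_on_compose2[OF contD[rule_format, of "(0, 1)"]]) auto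
  moreover have "h 0 = 0"
    using V by (simp add: h_def burgers_solution_def)
  ultimately have "h \<tau> = 0"
    using linear_ode_zero[OF \<tau>(1)] by blast
  then show ?thesis
    by (simp add: h_def)
qed

subsection \<open>Rays and their feet\<close>

text \<open>The slope bound keeps rays from crossing before \<open>T\<close>. That it is attained at
  some \<open>x0\<close> is assumed separately, in the results on maximality, blow-up and the
  profile.\<close>

locale burgers_characteristics =
  fixes u :: "real \<Rightarrow> real" and T :: real
  assumes smooth_u: "smooth_on UNIV u"
    and T_pos: "0 < T"
    and deriv_ge: "- 1 / T \<le> deriv u y"
begin

definition ray :: "real \<Rightarrow> real \<Rightarrow> real" where
  "ray t y = y + t * u y"

definition foot :: "real \<Rightarrow> real \<Rightarrow> real" where
  "foot t x = (THE y. ray t y = x)"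

definition sol :: "real \<Rightarrow> real \<Rightarrow> real" where
  "sol t x = u (foot t x)"

lemma has_deriv_u: "(u has_real_derivative deriv u y) (at y)"
  by (rule smooth_on_UNIV_has_deriv[OF smooth_u])

lemma jacobian_ge: "0 \<le> t \<Longrightarrow> 1 - t / T \<le> 1 + t * deriv u y"
  using mult_left_mono[OF deriv_ge[of y], of t] by simp

lemma jacobian_pos: "0 \<le> t \<Longrightarrow> t < T \<Longrightarrow> 0 < 1 + t * deriv u y"
  using jacobian_ge[of t y] T_pos by (smt (verit) divide_less_eq_1_pos)

text \<open>The spatial derivative of \<open>ray t\<close> is at least \<open>1 - t / T\<close>.
  Before \<open>T\<close> this linear growth yields injectivity and surjectivity; at
  \<open>t = T\<close> it still yields weak monotonicity.\<close>

lemma ray_growth: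
  assumes "0 \<le> t" "a \<le> b"
  shows "(1 - t / T) * (b - a) \<le> ray t b - ray t a"
proof -
  have "ray t a - (1 - t / T) * a \<le> ray t b - (1 - t / T) * b"
  proof (rule DERIV_nonneg_imp_nondecreasing[OF \<open>a \<le> b\<close>])
    fix y
    have "((\<lambda>y. ray t y - (1 - t / T) * y) has_real_derivative 1 + t * deriv u y - (1 - t / T)) (at y)"
      unfolding ray_def by (auto intro!: derivative_eq_intros has_deriv_u)
    then show "\<exists>d. ((\<lambda>y. ray t y - (1 - t / T) * y) has_real_derivative d) (at y) \<and> 0 \<le> d"
      using jacobian_ge[OF \<open>0 \<le> t\<close>, of y] by fastforce
  qed
  then show ?thesis
    by (simp add: algebra_simps diff_divide_distrib)
qed

lemma ray_mono: "0 \<le> t \<Longrightarrow> t \<le> T \<Longrightarrow> a \<le> b \<Longrightarrow> ray t a \<le> ray t b"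
  using ray_growth[of t a b] T_pos
  by (smt (verit) divide_le_eq_1_pos mult_nonneg_nonneg)

lemma ray_strict_mono:
  assumes "0 \<le> t" "t < T" "a < b"
  shows "ray t a < ray t b"
proof -
  have "0 < (1 - t / T) * (b - a)"
    using assms by (intro mult_pos_pos) auto
  then show ?thesis
    using ray_growth[of t a b] assms by linarith
qed

lemma ray_less_iff: "0 \<le> t \<Longrightarrow> t < T \<Longrightarrow> ray t a < ray t b \<longleftrightarrow> a < b"
  using ray_strict_mono[of t] by (metis less_asym linorder_neqE)

lemma ex1_foot:
  assumes "0 \<le> t" "t < T"
  shows "\<exists>!y. ray t y = x"
proof (rule ex_ex1I)
  \<comment> \<open>With this \<open>K\<close>, the guaranteed growth of \<open>ray t\<close> over
    \<open>{0..K}\<close> and over \<open>{- K..0}\<close> equals the distance from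
    \<open>ray t 0\<close> to \<open>x\<close>, so the two endpoint values enclose
    \<open>x\<close>.\<close>
  define K where "K = \<bar>x - ray t 0\<bar> / (1 - t / T)"
  have "0 < 1 - t / T"
    using assms by simp
  then have "0 \<le> K" and "(1 - t / T) * K = \<bar>x - ray t 0\<bar>"
    by (auto simp: K_def)
  with ray_growth[of t 0 K] ray_growth[of t "- K" 0] \<open>0 \<le> t\<close>
  have "\<bar>x - ray t 0\<bar> \<le> ray t 0 - ray t (- K)" "\<bar>x - ray t 0\<bar> \<le> ray t K - ray t 0"
    by auto
  then have "ray t (- K) \<le> x" "x \<le> ray t K"
    by linarith+
  moreover have "isCont (ray t) y" for y
    unfolding ray_def by (intro continuous_intros DERIV_isCont[OF has_deriv_u])
  ultimately show "\<exists>y. ray t y = x"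
    using IVT[of "ray t" "- K" x K] \<open>0 \<le> K\<close> by auto
next
  fix y z assume "ray t y = x" "ray t z = x"
  then show "y = z"
    using ray_less_iff[OF assms] by (metis less_irrefl linorder_neqE)
qed

lemma ray_foot: "0 \<le> t \<Longrightarrow> t < T \<Longrightarrow> ray t (foot t x) = x"
  unfolding foot_def by (rule theI'[OF ex1_foot])

lemma foot_ray: "0 \<le> t \<Longrightarrow> t < T \<Longrightarrow> foot t (ray t y) = y"
  using ex1_foot[of t "ray t y"] ray_foot[of t "ray t y"] by blast

text \<open>Order comparisons trade the implicit \<open>foot\<close> for the explicit
  \<open>ray\<close>; limits of \<open>foot\<close> are obtained from them.\<close>

lemma less_foot_iff: "0 \<le> t \<Longrightarrow> t < T \<Longrightarrow> y < foot t x \<longleftrightarrow> ray t y < x"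
  using ray_less_iff[of t y "foot t x"] by (simp add: ray_foot)

lemma foot_less_iff: "0 \<le> t \<Longrightarrow> t < T \<Longrightarrow> foot t x < y \<longleftrightarrow> x < ray t y"
  using ray_less_iff[of t "foot t x" y] by (simp add: ray_foot)

section \<open>Continuity and smoothness of the foot\<close>

lemma tendsto_ray: "((\<lambda>q. ray (fst q) y - snd q) \<longlongrightarrow> ray t y - x) (at (t, x) within S)"
proof -
  have "((\<lambda>q. ray (fst q) y - snd q) \<longlongrightarrow> ray (fst (t, x)) y - snd (t, x)) (at (t, x) within S)"
    unfolding ray_def by (intro tendsto_intros)
  then show ?thesis by simp
qed

text \<open>The point \<open>(t, x)\<close> need not lie in the strip: strict separation of the rays
  at the limiting time suffices, because \<open>ray\<close> is continuous in time. This allows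
  \<open>t = T\<close>, where the foot has no smooth inverse function behind it.\<close>

lemma foot_tendsto:
  assumes "S \<subseteq> {0..<T} \<times> UNIV"
    and below: "\<And>y. y < l \<Longrightarrow> ray t y < x"
    and above: "\<And>y. l < y \<Longrightarrow> x < ray t y"
  shows "((\<lambda>q. foot (fst q) (snd q)) \<longlongrightarrow> l) (at (t, x) within S)"
proof (rule order_tendstoI)
  have S: "\<forall>\<^sub>F q in at (t, x) within S. 0 \<le> fst q \<and> fst q < T"
    using assms(1) unfolding eventually_at_filter by (intro always_eventually) auto
  show "\<forall>\<^sub>F q in at (t, x) within S. y < foot (fst q) (snd q)" if "y < l" for y
  proof -
    have "\<forall>\<^sub>F q in at (t, x) within S. ray (fst q) y - snd q < 0"
      using below[OF that] by (intro order_tendstoD(2)[OF tendsto_ray]) simp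
    with S show ?thesis
      by eventually_elim (simp add: less_foot_iff)
  qed
  show "\<forall>\<^sub>F q in at (t, x) within S. foot (fst q) (snd q) < y" if "l < y" for y
  proof -
    have "\<forall>\<^sub>F q in at (t, x) within S. 0 < ray (fst q) y - snd q"
      using above[OF that] by (intro order_tendstoD(1)[OF tendsto_ray]) simp
    with S show ?thesis
      by eventually_elim (simp add: foot_less_iff)
  qed
qed

lemma foot_tendsto_interior:
  assumes "0 \<le> t" "t < T"
  shows "((\<lambda>q. foot (fst q) (snd q)) \<longlongrightarrow> foot t x) (at (t, x) within {0..<T} \<times> UNIV)"
  using less_foot_iff[OF assms] foot_less_iff[OF assms] by (intro foot_tendsto) auto

text \<open>With Caratheodory's slope function \<open>d\<close> of \<open>u\<close> at
  \<open>y\<close>, subtracting the two ray equations gives exactly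
  \<open>(y' - y) * J q = z - x - (s - t) * u y\<close>. Dividing by \<open>J q\<close>, which tends
  to the Jacobian, puts the increment in Caratheodory form.\<close>

lemma foot_has_derivative:
  assumes t: "0 \<le> t" "t < T"
  shows "((\<lambda>q. foot (fst q) (snd q)) has_derivative
      (\<lambda>v. (snd v - fst v * u (foot t x)) * inverse (1 + t * deriv u (foot t x))))
    (at (t, x) within {0..<T} \<times> UNIV)"
proof -
  define y where "y = foot t x"
  obtain d where d: "\<And>z. u z - u y = d z * (z - y)" and "isCont d y" and "d y = deriv u y"
    using has_deriv_u[of y] unfolding CARAT_DERIV by blast
  define J where "J q = 1 + fst q * d (foot (fst q) (snd q))" for q :: "real \<times> real"
  have "((\<lambda>q. d (foot (fst q) (snd q))) \<longlongrightarrow> d y) (at (t, x) within {0..<T} \<times> UNIV)"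
    using \<open>isCont d y\<close> foot_tendsto_interior[OF t] unfolding y_def by (rule isCont_tendsto_compose)
  moreover have "(fst \<longlongrightarrow> fst (t, x)) (at (t, x) within {0..<T} \<times> UNIV)"
    by (intro tendsto_intros)
  ultimately have "(J \<longlongrightarrow> 1 + t * deriv u y) (at (t, x) within {0..<T} \<times> UNIV)"
    unfolding J_def \<open>d y = deriv u y\<close> by (intro tendsto_intros) auto
  then have "((\<lambda>q. inverse (J q)) \<longlongrightarrow> inverse (1 + t * deriv u y)) (at (t, x) within {0..<T} \<times> UNIV)"
    using jacobian_pos[OF t, of y] by (intro tendsto_inverse) auto
  moreover have "bounded_linear (\<lambda>v. snd v - fst v * u y)"
    by (intro bounded_linear_intros)
  moreover have "foot (fst q) (snd q) - foot (fst (t, x)) (snd (t, x)) =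
      (snd (q - (t, x)) - fst (q - (t, x)) * u y) * inverse (J q)" if "q \<in> {0..<T} \<times> UNIV" for q
  proof -
    obtain s z where q: "q = (s, z)"
      by (cases q)
    with that have s: "0 \<le> s" "s < T"
      by auto
    define y' where "y' = foot s z"
    have "ray s y' - ray s y = (y' - y) * J q"
      using d[of y'] unfolding ray_def J_def q y'_def[symmetric] fst_conv snd_conv by algebra
    moreover have "ray s y' = z" "ray t y = x"
      using s t by (auto simp: y'_def y_def ray_foot)
    ultimately have eq: "(y' - y) * J q = z - x - (s - t) * u y"
      by (simp add: ray_def algebra_simps)
    \<comment> \<open>If the feet coincide, \<open>J q\<close> is the Jacobian at \<open>y\<close>
      at time \<open>s\<close>; otherwise it is a difference quotient of the injective map
      \<open>ray s\<close>.\<close>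
    have "J q \<noteq> 0"
    proof (cases "y' = y")
      case True
      then show ?thesis
        using jacobian_pos[OF s, of y] \<open>d y = deriv u y\<close> by (simp add: J_def q y'_def)
    next
      case False
      then have "ray s y' \<noteq> ray s y"
        using ray_less_iff[OF s] by (metis less_irrefl linorder_neqE)
      then show ?thesis
        using \<open>ray s y' - ray s y = (y' - y) * J q\<close> by auto
    qed
    then show ?thesis
      using eq by (simp add: q y_def[symmetric] y'_def[symmetric] field_simps)
  qed
  ultimately show ?thesis
    unfolding y_def by (intro has_derivative_caratheodory)
qed

text \<open>The derivative of the foot is a rational expression in time, \<open>u\<close> and
  \<open>deriv u\<close> evaluated at the foot, so \<open>C^k\<close> regularity of the foot implies
  \<open>C^(k+1)\<close>.\<close>

lemma Ck_on_foot: "Ck_on k ({0..<T} \<times> UNIV) (\<lambda>q. foot (fst q) (snd q))"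
proof (induction k)
  case 0
  then show ?case
    using foot_tendsto_interior by (auto simp: continuous_on_def)
next
  case (Suc k)
  let ?S = "{0..<T} \<times> (UNIV :: real set)"
  let ?D = "\<lambda>p v. (snd v - fst v * u (foot (fst p) (snd p))) *
    inverse (1 + fst p * deriv u (foot (fst p) (snd p)))"
  have u: "Ck_on k ?S (\<lambda>p. u (foot (fst p) (snd p)))"
    and u': "Ck_on k ?S (\<lambda>p. deriv u (foot (fst p) (snd p)))"
    using Ck_on_compose[OF smooth_u Suc.IH] Ck_on_compose[OF smooth_on_UNIV_deriv[OF smooth_u] Suc.IH]
    by simp_all
  have "Ck_on k ?S (\<lambda>p. snd v + (- fst v) * u (foot (fst p) (snd p)))" for v :: "real \<times> real"
    by (intro Ck_on_add Ck_on_mult Ck_on_const u)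
  moreover have "Ck_on k ?S (\<lambda>p. inverse (1 + fst p * deriv u (foot (fst p) (snd p))))"
  proof (rule Ck_on_inverse)
    show "1 + fst p * deriv u (foot (fst p) (snd p)) \<noteq> 0" if "p \<in> ?S" for p
      using jacobian_pos[of "fst p" "foot (fst p) (snd p)"] that by auto
    show "Ck_on k ?S (\<lambda>p. 1 + fst p * deriv u (foot (fst p) (snd p)))"
      by (intro Ck_on_add Ck_on_mult Ck_on_const u' Ck_on_bounded_linear bounded_linear_fst)
  qed
  ultimately have "Ck_on k ?S (\<lambda>p. (snd v + (- fst v) * u (foot (fst p) (snd p))) *
      inverse (1 + fst p * deriv u (foot (fst p) (snd p))))" for v :: "real \<times> real"
    by (rule Ck_on_mult)
  then have "\<forall>v. Ck_on k ?S (\<lambda>p. ?D p v)"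
    by simp
  moreover have "\<forall>p\<in>?S. ((\<lambda>q. foot (fst q) (snd q)) has_derivative ?D p) (at p within ?S)"
    using foot_has_derivative by auto
  ultimately show ?case
    unfolding Ck_on.simps by (intro exI[of _ ?D] conjI)
qed

section \<open>The solution, its maximality and its blow-up\<close>

lemma smooth_on_sol: "smooth_on ({0..<T} \<times> UNIV) (\<lambda>(t, x). sol t x)"
  unfolding smooth_on_def sol_def case_prod_beta
  using Ck_on_compose[OF smooth_u Ck_on_foot] by simp

lemma sol_has_derivative:
  assumes t: "0 \<le> t" "t < T"
  shows "((\<lambda>(t, x). sol t x) has_derivative
      (\<lambda>v. deriv u (foot t x) * ((snd v - fst v * u (foot t x)) * inverse (1 + t * deriv u (foot t x)))))
    (at (t, x) within {0..<T} \<times> UNIV)"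
  using has_derivative_compose[OF foot_has_derivative[OF t, of x], of u "(*) (deriv u (foot t x))"]
    has_deriv_u[of "foot t x"]
  unfolding sol_def case_prod_beta by (simp add: has_field_derivative_def)

lemma deriv_sol:
  assumes t: "0 \<le> t" "t < T"
  shows "deriv (sol t) x = deriv u (foot t x) / (1 + t * deriv u (foot t x))"
  using DERIV_imp_deriv[OF time_space_slices(2)[OF sol_has_derivative[OF t]]] t
  by (simp add: divide_inverse)

lemma burgers_solution_sol: "burgers_solution T u sol"
  unfolding burgers_solution_def
proof (intro conjI ballI allI)
  show "smooth_on ({0..<T} \<times> UNIV) (\<lambda>(t, x). sol t x)"
    by (rule smooth_on_sol)
  show "sol 0 x = u x" for x
    using foot_ray[of 0 x] T_pos by (simp add: sol_def ray_def)
  fix t x assume "t \<in> {0..<T}"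
  then have t: "0 \<le> t" "t < T" and t': "t \<in> {0..<T}" by auto
  show "vector_derivative (\<lambda>s. sol s x) (at t within {0..<T}) + sol t x * deriv (sol t) x = 0"
    unfolding time_space_slices(1)[OF sol_has_derivative[OF t] t'] deriv_sol[OF t]
    by (simp add: sol_def divide_inverse)
qed

lemma burgers_lifespan_le:
  assumes V: "burgers_solution S u V" and x0: "deriv u x0 = - 1 / T"
  shows "S \<le> T"
proof (rule ccontr)
  assume "\<not> S \<le> T"
  then have "T < S" by simp
  then have TS: "T \<in> {0..<S}"
    using T_pos by auto
  have "Ck_on (Suc 0) ({0..<S} \<times> UNIV) (\<lambda>(t, x). V t x)"
    using V unfolding burgers_solution_def smooth_on_def by blast
  then obtain D where "((\<lambda>(t, x). V t x) has_derivative D) (at (T, ray T x0) within {0..<S} \<times> UNIV)"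
    unfolding Ck_on.simps using TS by blast
  then have "(V T has_real_derivative D (0, 1)) (at (ray T x0))"
    using TS by (rule time_space_slices)
  \<comment> \<open>The rays focus at time \<open>T\<close>: the Jacobian
    \<open>1 + T * deriv u x0\<close> vanishes.\<close>
  moreover have "(ray T has_real_derivative 0) (at x0)"
    unfolding ray_def using T_pos x0 by (auto intro!: derivative_eq_intros has_deriv_u)
  ultimately have "((\<lambda>y. V T (ray T y)) has_real_derivative D (0, 1) * 0) (at x0)"
    by (rule DERIV_chain2)
  moreover have "(\<lambda>y. V T (ray T y)) = u"
    using burgers_solution_const_on_rays[OF V _ \<open>T < S\<close>] T_pos by (auto simp: ray_def)
  ultimately have "deriv u x0 = 0"
    using DERIV_imp_deriv by simp
  then show False
    using x0 T_pos by simp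
qed

lemma maximal_burgers_solution_sol:
  assumes "deriv u x0 = - 1 / T"
  shows "maximal_burgers_solution T u sol"
  unfolding maximal_burgers_solution_def
proof (intro conjI allI impI ballI)
  show "burgers_solution T u sol"
    by (rule burgers_solution_sol)
  fix S V assume V: "burgers_solution S u V"
  show "S \<le> T"
    by (rule burgers_lifespan_le[OF V assms])
  fix t x assume "t \<in> {0..<S}"
  with \<open>S \<le> T\<close> have t: "0 \<le> t" "t < S" "t < T" by auto
  show "V t x = sol t x"
    using burgers_solution_const_on_rays[OF V t(1,2), of "foot t x"] ray_foot[OF t(1,3), of x]
    by (simp add: ray_def sol_def)
qed

text \<open>On the ray from \<open>x0\<close> the slope of the solution is exactly
  \<open>- 1 / (T - t)\<close>, and this ray runs into the blow-up point.\<close>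

lemma blows_up_at_sol:
  assumes x0: "deriv u x0 = - 1 / T"
  shows "blows_up_at sol T (ray T x0)"
  unfolding blows_up_at_def
proof (intro conjI allI impI)
  fix \<epsilon> M :: real assume "0 < \<epsilon>"
  have "((\<lambda>t. ray t x0) \<longlongrightarrow> ray T x0) (at_left T)"
    unfolding ray_def by (intro tendsto_intros)
  then have "\<forall>\<^sub>F t in at_left T. dist (ray t x0) (ray T x0) < \<epsilon>"
    using \<open>0 < \<epsilon>\<close> by (rule tendstoD)
  \<comment> \<open>The lower end keeps \<open>t\<close> nonnegative and makes
    \<open>1 / (T - t)\<close> exceed \<open>\<bar>M\<bar> + 1\<close>.\<close>
  moreover have "\<forall>\<^sub>F t in at_left T. t \<in> {max 0 (T - 1 / (\<bar>M\<bar> + 1))<..<T}"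
    using T_pos by (intro eventually_at_left_real) auto
  ultimately show "\<forall>\<^sub>F t in at_left T. \<exists>x\<in>ball (ray T x0) \<epsilon>. M < \<bar>deriv (sol t) x\<bar>"
  proof eventually_elim
    case (elim t)
    then have t: "0 \<le> t" "t < T" and gap: "T - t < 1 / (\<bar>M\<bar> + 1)"
      by auto
    have "deriv (sol t) (ray t x0) = - 1 / (T - t)"
      using T_pos t by (simp add: deriv_sol foot_ray x0 field_simps)
    moreover have "\<bar>M\<bar> + 1 < 1 / (T - t)"
      using gap t by (simp add: field_simps)
    ultimately have "M < \<bar>deriv (sol t) (ray t x0)\<bar>"
      using t by simp
    then show ?case
      using elim(1) by (auto simp: dist_commute)
  qed
qed (use T_pos smooth_on_sol in auto)

end

subsection \<open>Asymptotics of the foot\<close>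

lemma odd_binomial_le_cancel:
  fixes v w :: real
  assumes "0 < A" "0 \<le> B" "odd k" and "A * v + B * v ^ k \<le> A * w + B * w ^ k"
  shows "v \<le> w"
proof (rule ccontr)
  assume "\<not> v \<le> w"
  then have "A * w < A * v" and "B * w ^ k \<le> B * v ^ k"
    using assms by (auto intro!: mult_left_mono power_mono_odd)
  then show False
    using assms(4) by linarith
qed

text \<open>For \<open>y \<ge> 0\<close> the points \<open>(1 - \<epsilon>) * y\<close> and
  \<open>(1 + \<epsilon>) * y\<close> enclose \<open>z\<close>: the binomial is strictly increasing,
  and \<open>k \<ge> 1\<close> gives \<open>(1 - \<epsilon>) ^ k \<le> 1 - \<epsilon>\<close> and
  \<open>1 + \<epsilon> \<le> (1 + \<epsilon>) ^ k\<close>. Negative \<open>y\<close> follow by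
  oddness. The bound is uniform in \<open>A\<close>, which is essential since \<open>A\<close> will
  be \<open>(T - t) / T\<close>, tending to 0.\<close>

lemma odd_binomial_root_perturbation:
  fixes y z :: real
  assumes A: "0 < A" and B: "0 \<le> B" and k: "odd k" and \<epsilon>: "0 \<le> \<epsilon>" "\<epsilon> \<le> 1"
    and \<beta>: "\<bar>\<beta> - B\<bar> \<le> \<epsilon> * B"
    and eq: "A * z + B * z ^ k = A * y + \<beta> * y ^ k"
  shows "\<bar>z - y\<bar> \<le> \<epsilon> * \<bar>y\<bar>"
proof -
  have nonneg: "\<bar>z - y\<bar> \<le> \<epsilon> * y"
    if "0 \<le> y" and eq: "A * z + B * z ^ k = A * y + \<beta> * y ^ k" for y z
  proof -
    have "0 < k"
      using k by (rule odd_pos)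
    have "1 + \<epsilon> \<le> (1 + \<epsilon>) ^ k"
      using \<epsilon> \<open>0 < k\<close> self_le_power[of "1 + \<epsilon>" k] by simp
    then have "(1 + \<epsilon>) * B \<le> (1 + \<epsilon>) ^ k * B"
      using B by (rule mult_right_mono)
    then have "\<beta> \<le> (1 + \<epsilon>) ^ k * B"
      using \<beta> by (simp add: algebra_simps abs_le_iff)
    then have "\<beta> * y ^ k \<le> (1 + \<epsilon>) ^ k * B * y ^ k"
      using \<open>0 \<le> y\<close> by (intro mult_right_mono) auto
    moreover have "A * y \<le> A * ((1 + \<epsilon>) * y)"
      using A \<epsilon> \<open>0 \<le> y\<close> by (intro mult_left_mono) (auto simp: algebra_simps)
    ultimately have "A * z + B * z ^ k \<le> A * ((1 + \<epsilon>) * y) + B * ((1 + \<epsilon>) * y) ^ k"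
      unfolding eq power_mult_distrib by (simp add: mult_ac)
    then have upper: "z \<le> (1 + \<epsilon>) * y"
      by (rule odd_binomial_le_cancel[OF A B k])
    have "(1 - \<epsilon>) ^ k \<le> 1 - \<epsilon>"
      using \<epsilon> \<open>0 < k\<close> power_decreasing[of 1 k "1 - \<epsilon>"] by simp
    then have "(1 - \<epsilon>) ^ k * B \<le> (1 - \<epsilon>) * B"
      using B by (rule mult_right_mono)
    then have "(1 - \<epsilon>) ^ k * B \<le> \<beta>"
      using \<beta> by (simp add: algebra_simps abs_le_iff)
    then have "(1 - \<epsilon>) ^ k * B * y ^ k \<le> \<beta> * y ^ k"
      using \<open>0 \<le> y\<close> by (intro mult_right_mono) auto
    moreover have "A * ((1 - \<epsilon>) * y) \<le> A * y"
      using A \<epsilon> \<open>0 \<le> y\<close> by (intro mult_left_mono) (auto simp: algebra_simps)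
    ultimately have "A * ((1 - \<epsilon>) * y) + B * ((1 - \<epsilon>) * y) ^ k \<le> A * z + B * z ^ k"
      unfolding eq power_mult_distrib by (simp add: mult_ac)
    then have "(1 - \<epsilon>) * y \<le> z"
      by (rule odd_binomial_le_cancel[OF A B k])
    with upper show ?thesis
      by (simp add: algebra_simps abs_le_iff)
  qed
  show ?thesis
  proof (cases "0 \<le> y")
    case True
    then show ?thesis
      using nonneg eq by simp
  next
    case False
    then have "\<bar>- z - - y\<bar> \<le> \<epsilon> * - y"
      using eq k by (intro nonneg) auto
    with False show ?thesis
      by (simp add: abs_minus_commute)
  qed
qed

text \<open>Undoes the self-similar scaling: with \<open>p ^ (2 * i) = s\<close>, the fractional
  powers drop out and the profile satisfies a polynomial equation, comparable with the equation of
  the foot.\<close>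

lemma scaled_Psi_implicit:
  fixes s X \<mu> :: real
  assumes "1 \<le> i" "0 < s" "0 < \<mu>"
  defines "P \<equiv> s powr (1 / (2 * real i)) * \<Psi> i (\<mu> * (X / s powr (1 + 1 / (2 * real i))))"
  shows "\<mu> * X = - s * P - P ^ (2 * i + 1)"
proof -
  define p where "p = s powr (1 / (2 * real i))"
  define Y where "Y = \<Psi> i (\<mu> * (X / (s * p)))"
  have "0 < p"
    using assms by (simp add: p_def)
  have pow: "p ^ (2 * i) = s"
    using assms by (simp add: p_def powr_power)
  have P: "P = p * Y"
    using assms by (simp add: P_def p_def Y_def powr_add)
  have "\<mu> * (X / (s * p)) = - Y - Y ^ (1 + 2 * i)"
    unfolding Y_def by (rule Psi_implicit)
  then have "\<mu> * X = s * p * (- Y - Y ^ (1 + 2 * i))"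
    using \<open>0 < p\<close> \<open>0 < s\<close> by (simp add: field_simps)
  also have "\<dots> = - s * (p * Y) - p ^ (2 * i) * p * Y ^ (2 * i + 1)"
    unfolding pow by (simp add: algebra_simps)
  also have "\<dots> = - s * P - P ^ (2 * i + 1)"
    unfolding P power_mult_distrib by (simp add: algebra_simps)
  finally show ?thesis .
qed

section \<open>The self-similar profile near the blow-up point\<close>

context burgers_characteristics
begin

lemma sol_asymptotics:
  fixes x0 \<mu> :: real and i :: nat
  assumes x0: "deriv u x0 = - 1 / T" and i: "1 \<le> i"
    and flat: "\<forall>j\<in>{2..2 * i}. (deriv ^^ j) u x0 = 0"
    and pos: "0 < (deriv ^^ (2 * i + 1)) u x0"
    and \<mu>: "0 < \<mu>" "\<mu> ^ (2 * i) = (deriv ^^ (2 * i + 1)) u x0 / fact (2 * i + 1) * T ^ (2 * i + 2)"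
  defines "P \<equiv> \<lambda>t x. (T - t) powr (1 / (2 * real i)) *
      \<Psi> i (\<mu> * ((x - x0 - u x0 * t) / (T - t) powr (1 + 1 / (2 * real i))))"
  shows "((\<lambda>(t, x). (sol t x - u x0) / P t x) \<longlongrightarrow> inverse \<mu>)
    (at (T, ray T x0) within {(t, x). 0 \<le> t \<and> t < T \<and> P t x \<noteq> 0})"
proof -
  define k where "k = 2 * i + 1"
  define b where "b = (deriv ^^ k) u x0 / fact k"
  have "0 < b" and "odd k"
    using pos by (simp_all add: b_def k_def)
  obtain r where r: "isCont r x0" "r x0 = b"
    and taylor: "\<And>x. u x = (\<Sum>m<k. (deriv ^^ m) u x0 / fact m * (x - x0) ^ m) + r x * (x - x0) ^ k"
    using taylor_continuous_remainder[OF smooth_u, of k x0] unfolding b_def k_def by auto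
  \<comment> \<open>The coefficients of degree 2 to \<open>2 * i\<close> vanish by flatness, leaving
    only the constant, the slope \<open>- 1 / T\<close> and the remainder of degree
    \<open>k\<close>.\<close>
  have u_eq: "u x = u x0 - (x - x0) / T + r x * (x - x0) ^ k" for x
  proof -
    have "(\<Sum>m<k. (deriv ^^ m) u x0 / fact m * (x - x0) ^ m) =
        (\<Sum>m\<in>{0, 1}. (deriv ^^ m) u x0 / fact m * (x - x0) ^ m)"
      using i flat by (intro sum.mono_neutral_right) (auto simp: k_def)
    then show ?thesis
      using taylor[of x] x0 by simp
  qed
  have ray_eq: "ray t x - ray t x0 = (T - t) * ((x - x0) / T) + t * r x * (x - x0) ^ k" for t x
    using T_pos unfolding ray_def u_eq[of x] by (simp add: field_simps)

  have "(r \<longlongrightarrow> b) (at x0)"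
    using r by (simp add: isCont_def)
  then have "\<forall>\<^sub>F x in at x0. 0 < r x"
    using \<open>0 < b\<close> by (rule order_tendstoD)
  then obtain \<delta> where "0 < \<delta>" and r_pos: "\<And>x. x \<noteq> x0 \<Longrightarrow> dist x x0 < \<delta> \<Longrightarrow> 0 < r x"
    unfolding eventually_at by auto
  \<comment> \<open>At \<open>t = T\<close> the bound of \<open>ray_growth\<close> degenerates.
    Strictness comes from the remainder, whose coefficient is positive within
    \<open>\<delta>\<close> of \<open>x0\<close> and whose power is odd; weak monotonicity of
    \<open>ray T\<close> carries it from the clamped point \<open>x'\<close> to
    \<open>x\<close>.\<close>
  have below: "ray T x < ray T x0" if "x < x0" for x
  proof -
    define x' where "x' = max x (x0 - \<delta> / 2)"
    have "x' < x0" "0 < r x'" "x \<le> x'"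
      using r_pos[of x'] \<open>0 < \<delta>\<close> that by (auto simp: x'_def dist_real_def)
    then have "r x' * (x' - x0) ^ k < 0"
      using \<open>odd k\<close> by (intro mult_pos_neg) (auto simp: power_less_zero_eq)
    then have "T * (r x' * (x' - x0) ^ k) < 0"
      by (rule mult_pos_neg[OF T_pos])
    then have "ray T x' < ray T x0"
      using ray_eq[of T x'] by (simp add: mult.assoc)
    moreover have "ray T x \<le> ray T x'"
      using \<open>x \<le> x'\<close> T_pos by (intro ray_mono) auto
    ultimately show ?thesis by simp
  qed
  have above: "ray T x0 < ray T x" if "x0 < x" for x
  proof -
    define x' where "x' = min x (x0 + \<delta> / 2)"
    have "x0 < x'" "0 < r x'" "x' \<le> x"
      using r_pos[of x'] \<open>0 < \<delta>\<close> that by (auto simp: x'_def dist_real_def)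
    then have "0 < r x' * (x' - x0) ^ k"
      by simp
    then have "0 < T * (r x' * (x' - x0) ^ k)"
      by (rule mult_pos_pos[OF T_pos])
    then have "ray T x0 < ray T x'"
      using ray_eq[of T x'] by (simp add: mult.assoc)
    moreover have "ray T x' \<le> ray T x"
      using \<open>x' \<le> x\<close> T_pos by (intro ray_mono) auto
    ultimately show ?thesis by simp
  qed

  define S where "S = {(t, x). 0 \<le> t \<and> t < T \<and> P t x \<noteq> 0}"
  define F where "F = at (T, ray T x0) within S"
  define f where "f q = foot (fst q) (snd q)" for q
  define y where "y q = f q - x0" for q
  \<comment> \<open>The factor \<open>- T / \<mu>\<close> turns the profile into the foot
    displacement of the model problem, in which the coefficient \<open>t * r\<close> is frozen at
    its limit \<open>T * b\<close>.\<close>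
  define z where "z q = - T / \<mu> * P (fst q) (snd q)" for q
  have f: "(f \<longlongrightarrow> x0) F"
    unfolding F_def f_def using below above by (intro foot_tendsto) (auto simp: S_def)
  then have y: "(y \<longlongrightarrow> 0) F"
    unfolding y_def by (simp add: LIM_zero)
  have rf: "((\<lambda>q. r (f q)) \<longlongrightarrow> b) F"
    using isCont_tendsto_compose[OF r(1) f] by (simp add: r)
  have "(fst \<longlongrightarrow> fst (T, ray T x0)) F"
    unfolding F_def by (intro tendsto_intros)
  then have \<beta>: "((\<lambda>q. fst q * r (f q)) \<longlongrightarrow> T * b) F"
    using rf by (auto intro: tendsto_mult)
  have S: "\<forall>\<^sub>F q in F. q \<in> S"
    unfolding F_def by (simp add: eventually_at_filter)
  have eq: "(T - fst q) / T * z q + T * b * z q ^ k = (T - fst q) / T * y q + fst q * r (f q) * y q ^ k"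
    if "q \<in> S" for q
  proof -
    obtain t x where q: "q = (t, x)" by (cases q)
    with that have t: "0 \<le> t" "t < T" by (auto simp: S_def)
    \<comment> \<open>Equivalently \<open>(\<mu> / T) ^ k = \<mu> * T * b\<close>, the identity that
      fixes the value of \<open>\<mu>\<close>.\<close>
    have \<mu>k: "\<mu> ^ k = \<mu> * (b * (T * T ^ k))"
      using \<mu>(2) by (simp add: k_def b_def)
    have P: "P t x = - (\<mu> / T * z q)"
      using T_pos \<mu> by (simp add: z_def q)
    have "\<mu> * (x - x0 - u x0 * t) = - (T - t) * P t x - P t x ^ k"
      unfolding P_def k_def using i t \<mu> by (intro scaled_Psi_implicit) auto
    also have "\<dots> = (T - t) * (\<mu> / T * z q) + (\<mu> / T) ^ k * z q ^ k"
      unfolding P power_minus_odd[OF \<open>odd k\<close>] power_mult_distrib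
        mult_minus_left mult_minus_right minus_minus diff_minus_eq_add ..
    also have "\<dots> = \<mu> * ((T - t) / T * z q + T * b * z q ^ k)"
      using T_pos by (simp add: power_divide \<mu>k algebra_simps)
    finally have "x - x0 - u x0 * t = (T - t) / T * z q + T * b * z q ^ k"
      using \<mu> by simp
    moreover have "x - x0 - u x0 * t = ray t (f q) - ray t x0"
      using ray_foot[OF t, of x] by (simp add: f_def q ray_def[of t x0])
    ultimately show ?thesis
      unfolding ray_eq by (simp add: y_def q)
  qed
  have "\<forall>\<^sub>F q in F. \<bar>z q - y q\<bar> \<le> \<epsilon> * \<bar>y q\<bar>" if "0 < \<epsilon>" "\<epsilon> \<le> 1" for \<epsilon>
  proof -
    have "\<forall>\<^sub>F q in F. dist (fst q * r (f q)) (T * b) < \<epsilon> * (T * b)"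
      using \<open>0 < \<epsilon>\<close> \<open>0 < b\<close> T_pos by (intro tendstoD[OF \<beta>]) simp
    with S show ?thesis
    proof eventually_elim
      case (elim q)
      then have "0 < (T - fst q) / T"
        using T_pos by (auto simp: S_def)
      then show ?case
        using elim \<open>odd k\<close> \<open>0 < b\<close> T_pos that eq[of q]
        by (intro odd_binomial_root_perturbation[where A = "(T - fst q) / T" and B = "T * b"
              and \<beta> = "fst q * r (f q)"]) (auto simp: dist_real_def)
    qed
  qed note close = this
  \<comment> \<open>A nonzero denominator \<open>P\<close> means \<open>z \<noteq> 0\<close>, and
    the relative bound then rules out \<open>y = 0\<close>; hence both quotients
    \<open>z / y\<close> and \<open>y / z\<close> make sense.\<close>
  have nz: "y q \<noteq> 0" "z q \<noteq> 0" if "q \<in> S" "\<bar>z q - y q\<bar> \<le> \<epsilon> * \<bar>y q\<bar>" for q \<epsilon>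
  proof -
    show "z q \<noteq> 0"
      using that(1) T_pos \<mu>(1) by (auto simp: z_def S_def)
    with that(2) show "y q \<noteq> 0"
      by auto
  qed
  have "((\<lambda>q. z q / y q) \<longlongrightarrow> 1) F"
  proof (rule tendstoI)
    fix e :: real assume "0 < e"
    define \<epsilon> where "\<epsilon> = min 1 (e / 2)"
    have "0 < \<epsilon>" "\<epsilon> \<le> 1" "\<epsilon> < e"
      using \<open>0 < e\<close> by (auto simp: \<epsilon>_def)
    show "\<forall>\<^sub>F q in F. dist (z q / y q) 1 < e"
      using close[OF \<open>0 < \<epsilon>\<close> \<open>\<epsilon> \<le> 1\<close>] S
    proof eventually_elim
      case (elim q)
      have "dist (z q / y q) 1 = \<bar>z q - y q\<bar> / \<bar>y q\<bar>"
        using nz[OF elim(2,1)] by (simp add: dist_real_def diff_divide_distrib flip: abs_divide)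
      also have "\<dots> \<le> \<epsilon>"
        using elim(1) nz[OF elim(2,1)] by (simp add: field_simps)
      finally show ?case
        using \<open>\<epsilon> < e\<close> by simp
    qed
  qed
  \<comment> \<open>This product is \<open>(sol - u x0) / P\<close> rewritten: the numerator is
    \<open>- (y / T) * (1 - T * r * y ^ (2 * i))\<close> by Taylor, and the denominator is
    \<open>- (\<mu> / T) * z\<close>.\<close>
  then have "((\<lambda>q. inverse \<mu> * inverse (z q / y q) * (1 - T * r (f q) * y q ^ (2 * i))) \<longlongrightarrow>
      inverse \<mu> * inverse 1 * (1 - T * b * 0 ^ (2 * i))) F"
    using rf y by (intro tendsto_intros) auto
  then have "((\<lambda>q. inverse \<mu> * inverse (z q / y q) * (1 - T * r (f q) * y q ^ (2 * i))) \<longlongrightarrow>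
      inverse \<mu>) F"
    using i by (simp add: power_0_left)
  moreover have "\<forall>\<^sub>F q in F. inverse \<mu> * inverse (z q / y q) * (1 - T * r (f q) * y q ^ (2 * i)) =
      (\<lambda>(t, x). (sol t x - u x0) / P t x) q"
    using close[OF zero_less_one order_refl] S
  proof eventually_elim
    case (elim q)
    note nz = nz[OF elim(2,1)]
    obtain t x where q: "q = (t, x)" by (cases q)
    have "sol t x - u x0 = u (f q) - u x0"
      by (simp add: sol_def f_def q)
    also have "\<dots> = - y q / T + r (f q) * y q ^ k"
      using u_eq[of "f q"] by (simp add: y_def diff_divide_distrib)
    also have "\<dots> = - (y q / T) * (1 - T * r (f q) * y q ^ (2 * i))"
      using T_pos by (simp add: k_def algebra_simps)
    finally have sol_eq: "sol t x - u x0 = - (y q / T) * (1 - T * r (f q) * y q ^ (2 * i))" .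
    have P_eq: "P t x = - (\<mu> / T) * z q"
      using T_pos \<mu> by (simp add: z_def q)
    have "inverse \<mu> * inverse (z q / y q) * W = - (y q / T) * W / (- (\<mu> / T) * z q)" for W
      using nz T_pos \<mu>(1) by (simp add: field_simps)
    then show ?case
      by (simp only: q case_prod_conv sol_eq[unfolded q] P_eq[unfolded q])
  qed
  ultimately show ?thesis
    unfolding F_def S_def by (rule Lim_transform_eventually)
qed

end

section \<open>Assembling maximality, blow-up and the profile\<close>

theorem proposition9:
  fixes U0 :: "real \<Rightarrow> real" and x0 c T xinf \<mu> :: real and i :: nat
  assumes "smooth_on UNIV U0"
    and "i \<ge> 1"
    and "\<forall>x. deriv U0 x0 \<le> deriv U0 x"
    and "U0 x0 = c"
    and "deriv U0 x0 < 0"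
    and "\<forall>j\<in>{2..2 * i}. (deriv ^^ j) U0 x0 = 0"
    and "(deriv ^^ (2 * i + 1)) U0 x0 > 0"
  defines "T \<equiv> - 1 / deriv U0 x0"
    and "xinf \<equiv> x0 + c * T"
    and "\<mu> \<equiv> ((deriv ^^ (2 * i + 1)) U0 x0 /
              (fact (2 * i + 1) * (- deriv U0 x0) ^ (2 * i + 2))) powr (1 / (2 * real i))"
  shows "\<exists>U w. maximal_burgers_solution T U0 U \<and>
           blows_up_at U T xinf \<and>
           (\<forall>t\<in>{0..<T}. \<forall>x.
              U t x = inverse \<mu> * (T - t) powr (1 / (2 * real i)) *
                        \<Psi> i (\<mu> * ((x - x0 - c * t) / (T - t) powr (1 + 1 / (2 * real i)))) +
                      c + w t x) \<and>
           (let D = (\<lambda>t x. (T - t) powr (1 / (2 * real i)) *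
                        \<Psi> i (\<mu> * ((x - x0 - c * t) / (T - t) powr (1 + 1 / (2 * real i)))))
            in ((\<lambda>(t, x). w t x / D t x) \<longlongrightarrow> 0)
                 (at (T, xinf) within {(t, x). 0 \<le> t \<and> t < T \<and> D t x \<noteq> 0}))"
proof -
  have "0 < T" and T_inv: "deriv U0 x0 = - 1 / T"
    using assms(5) by (auto simp: T_def divide_simps)
  then interpret burgers_characteristics U0 T
    using assms(1,3) by unfold_locales auto
  \<comment> \<open>Since \<open>- deriv U0 x0 = 1 / T\<close>, this is the base of the power
    defining \<open>\<mu>\<close>, in the form expected by \<open>sol_asymptotics\<close>.\<close>
  define \<alpha> where "\<alpha> = (deriv ^^ (2 * i + 1)) U0 x0 / fact (2 * i + 1) * T ^ (2 * i + 2)"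
  have "0 < \<alpha>"
    unfolding \<alpha>_def using assms(7) \<open>0 < T\<close> by (intro mult_pos_pos divide_pos_pos) auto
  have \<mu>_eq: "\<mu> = \<alpha> powr (1 / (2 * real i))"
    unfolding \<mu>_def \<alpha>_def T_inv by (simp add: power_divide)
  have "0 < \<mu>" and \<mu>_pow: "\<mu> ^ (2 * i) = \<alpha>"
    using \<open>0 < \<alpha>\<close> \<open>i \<ge> 1\<close> by (simp_all add: \<mu>_eq powr_power)
  define D where "D = (\<lambda>t x. (T - t) powr (1 / (2 * real i)) *
      \<Psi> i (\<mu> * ((x - x0 - c * t) / (T - t) powr (1 + 1 / (2 * real i)))))"
  \<comment> \<open>Taking \<open>w\<close> as the remainder makes the decomposition an identity;
    its smallness is the limit \<open>(sol - c) / D \<rightarrow> inverse \<mu>\<close>.\<close>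
  define w where "w t x = sol t x - c - inverse \<mu> * D t x" for t x
  have xinf: "xinf = ray T x0"
    by (simp add: xinf_def ray_def assms(4))
  have "((\<lambda>(t, x). (sol t x - c) / D t x) \<longlongrightarrow> inverse \<mu>)
      (at (T, xinf) within {(t, x). 0 \<le> t \<and> t < T \<and> D t x \<noteq> 0})"
    using sol_asymptotics[OF T_inv assms(2,6,7) \<open>0 < \<mu>\<close> \<mu>_pow[unfolded \<alpha>_def]]
    unfolding D_def xinf assms(4) .
  then have "((\<lambda>q. (\<lambda>(t, x). (sol t x - c) / D t x) q - inverse \<mu>) \<longlongrightarrow> 0)
      (at (T, xinf) within {(t, x). 0 \<le> t \<and> t < T \<and> D t x \<noteq> 0})"
    by (rule LIM_zero)
  moreover have "\<forall>\<^sub>F q in at (T, xinf) within {(t, x). 0 \<le> t \<and> t < T \<and> D t x \<noteq> 0}.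
      (\<lambda>(t, x). (sol t x - c) / D t x) q - inverse \<mu> = (\<lambda>(t, x). w t x / D t x) q"
    unfolding eventually_at_filter
    by (intro always_eventually) (auto simp: w_def diff_divide_distrib)
  ultimately have "((\<lambda>(t, x). w t x / D t x) \<longlongrightarrow> 0)
      (at (T, xinf) within {(t, x). 0 \<le> t \<and> t < T \<and> D t x \<noteq> 0})"
    by (rule Lim_transform_eventually)
  moreover have "\<forall>t\<in>{0..<T}. \<forall>x. sol t x = inverse \<mu> * (T - t) powr (1 / (2 * real i)) *
        \<Psi> i (\<mu> * ((x - x0 - c * t) / (T - t) powr (1 + 1 / (2 * real i)))) + c + w t x"
    by (simp add: w_def D_def mult.assoc)
  ultimately show ?thesis
    using maximal_burgers_solution_sol[OF T_inv] blows_up_at_sol[OF T_inv]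
    unfolding Let_def D_def xinf by blast
qed

end
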